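(* Assume $\mathcal{D}\cap\mathcal{T}=\emptyset$, $\mathcal{D}\cap\mathcal{B}=\emptyset$ and $\mathcal{T}\cap\mathcal{C}=\emptyset$, and let $\mathcal{Z}^\circ(\mathcal{B})$ be computed from the initialization $\mathcal{Z}_0=\mathcal{V}\setminus\mathcal{T}$. Let $\mathcal{P}$ be the union of all $\mathcal{D}$-to-$\mathcal{T}$ paths. Then: (a) if $\mathcal{B}$ is a feasible solution of Problem 2A, then $\mathcal{B}\supseteq\partial_+(\mathcal{Z}^\circ(\mathcal{B}),A)$; (b) if $\mathcal{B}$ is an optimal solution of Problem 2A, then $\mathcal{B}=\partial_+(\mathcal{Z}^\circ(\mathcal{B}),A)\cap\mathcal{P}=\partial_+(\mathcal{Z}^\circ(\mathcal{B}),A)$; (c) $\mathcal{B}$ is an optimal solution of Problem 2A if and only if it is the minimal cardinality set of nodes for which $\mathcal{B}=\partial_+(\mathcal{Z}^\circ(\mathcal{B}),A)\cap\mathcal{P}=\partial_+(\mathcal{Z}^\circ(\mathcal{B}),A)$.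
   Context: Let $(\mathcal{V},\mathcal{E},A)$ be a digraph with $\mathcal{V}=\{v_1,\dots,v_n\}$, where $(v_i,v_j)\in\mathcal{E}$ means $v_i\to v_j$, and $A\in\mathbb{R}^{n\times n}$ has $A_{ji}\ne0$ if and only if $(v_i,v_j)\in\mathcal{E}$. $\mathcal{D},\mathcal{T}\subset\mathcal{V}$ are given sets of disturbance and target nodes; $\mathcal{B}\subseteq\mathcal{V}$ is the set of input nodes, to be chosen, and $\mathcal{C}\subseteq\mathcal{V}$ is the set of output nodes (which plays no role in Problem 2A). $\mathcal{Z}^\circ(\mathcal{B})$ is the (stationary) limit of the recursion $\mathcal{Z}_0=\mathcal{V}\setminus\mathcal{T}$, $\mathcal{Z}_{k+1}=\mathcal{Z}_k\setminus\{v_i\in\mathcal{Z}_k:\exists\,(v_i,v_j)\in\mathcal{E}\text{ with }v_j\notin\mathcal{Z}_k\cup\mathcal{B}\}$; it is the maximal controlled invariant set of nodes contained in $\mathcal{V}\setminus\mathcal{T}$, i.e. the maximal subset $\mathcal{Z}$ of $\mathcal{V}\setminus\mathcal{T}$ such that every edge starting in $\mathcal{Z}$ ends in $\mathcal{Z}\cup\mathcal{B}$. Problem 2A (minimal input cardinality disturbance decoupling by state feedback): minimize $|\mathcal{B}|$ over $\mathcal{B}$ subject to $\mathcal{D}\subseteq\mathcal{Z}^\circ(\mathcal{B})$. A set $\mathcal{B}$ is called feasible for Problem 2A if it satisfies $\mathcal{D}\subseteq\mathcal{Z}^\circ(\mathcal{B})$ but is not necessarily of minimal cardinality; an optimal solution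 is a minimizer. The out-boundary of $\mathcal{W}\subseteq\mathcal{V}$ is $\partial_+(\mathcal{W},A)=\{v_j\in\mathcal{V}\setminus\mathcal{W}:\exists\,(v_i,v_j)\in\mathcal{E},\ v_i\in\mathcal{W}\}$. A $\mathcal{D}$-to-$\mathcal{T}$ path is a sequence of distinct nodes, the first in $\mathcal{D}$ and the last in $\mathcal{T}$, in which each consecutive pair is an edge; a path is identified with its set of nodes.
   Formalization: In (c) the minimum is taken over feasible sets of Problem 2A satisfying the two equalities, since the empty set always satisfies them and need not be feasible; "the minimal cardinality set" is read as "a set of minimal cardinality". *)

theory Defs
  imports Complex_Main "Graph_Theory.Graph_Theory"
begin

primrec Z_iter :: "'a pair_pre_digraph \<Rightarrow> 'a set \<Rightarrow> 'a set \<Rightarrow> nat \<Rightarrow> 'a set" where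
  "Z_iter G T B 0 = pverts G - T"
| "Z_iter G T B (Suc k) =
     Z_iter G T B k - {v \<in> Z_iter G T B k. \<exists>w. (v, w) \<in> parcs G \<and> w \<notin> Z_iter G T B k \<union> B}"

text \<open>The value at which the recursion becomes stationary. It exists whenever the node set is
  finite, see \<open>Z_lim_stationary\<close> below.\<close>

definition Z_lim :: "'a pair_pre_digraph \<Rightarrow> 'a set \<Rightarrow> 'a set \<Rightarrow> 'a set" where
  "Z_lim G T B = (THE Z. eventually (\<lambda>k. Z_iter G T B k = Z) sequentially)"

definition out_boundary :: "'a pair_pre_digraph \<Rightarrow> 'a set \<Rightarrow> 'a set" where
  "out_boundary G W = {w \<in> pverts G - W. \<exists>v \<in> W. (v, w) \<in> parcs G}"

definition feasible :: "'a pair_pre_digraph \<Rightarrow> 'a set \<Rightarrow> 'a set \<Rightarrow> 'a set \<Rightarrow> bool" where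
  "feasible G D T B \<longleftrightarrow> B \<subseteq> pverts G \<and> D \<subseteq> Z_lim G T B"

definition optimal :: "'a pair_pre_digraph \<Rightarrow> 'a set \<Rightarrow> 'a set \<Rightarrow> 'a set \<Rightarrow> bool" where
  "optimal G D T B \<longleftrightarrow> is_arg_min card (feasible G D T) B"

definition path_nodes :: "'a pair_pre_digraph \<Rightarrow> 'a set \<Rightarrow> 'a set \<Rightarrow> 'a set" where
  "path_nodes G D T = \<Union> {set p | p. vpath p (with_proj G) \<and> hd p \<in> D \<and> last p \<in> T}"

definition boundary_condition :: "'a pair_pre_digraph \<Rightarrow> 'a set \<Rightarrow> 'a set \<Rightarrow> 'a set \<Rightarrow> bool" where
  "boundary_condition G D T B \<longleftrightarrow>
     B = out_boundary G (Z_lim G T B) \<inter> path_nodes G D T \<and>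
     out_boundary G (Z_lim G T B) \<inter> path_nodes G D T = out_boundary G (Z_lim G T B)"

lemma Z_iter_decseq: "decseq (Z_iter G T B)"
  by (rule decseq_SucI) auto

lemma Z_iter_eventually_const:
  assumes "finite (pverts G)"
  shows "\<exists>Z. eventually (\<lambda>k. Z_iter G T B k = Z) sequentially"
proof -
  have sub: "Z_iter G T B k \<subseteq> pverts G" for k
    by (induction k) auto
  obtain m where m: "\<And>k. card (Z_iter G T B m) \<le> card (Z_iter G T B k)"
    using ex_has_least_nat[of "\<lambda>_. True" undefined "\<lambda>k. card (Z_iter G T B k)"] by blast
  have "Z_iter G T B k = Z_iter G T B m" if "m \<le> k" for k
    using that m[of k] finite_subset[OF sub assms] Z_iter_decseq[of G T B]
    by (intro card_seteq) (auto dest: decseqD)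
  then show ?thesis
    by (auto simp: eventually_sequentially)
qed

lemma Z_lim_stationary:
  assumes "finite (pverts G)"
  shows "eventually (\<lambda>k. Z_iter G T B k = Z_lim G T B) sequentially"
proof -
  obtain Z where Z: "eventually (\<lambda>k. Z_iter G T B k = Z) sequentially"
    using Z_iter_eventually_const[OF assms] by blast
  have "Z' = Z" if "eventually (\<lambda>k. Z_iter G T B k = Z') sequentially" for Z'
    using eventually_conj[OF Z that] by (auto simp: eventually_sequentially)
  then have "Z_lim G T B = Z"
    unfolding Z_lim_def by (intro the_equality Z)
  with Z show ?thesis by simp
qed

lemma Z_lim_subset:
  assumes "finite (pverts G)"
  shows "Z_lim G T B \<subseteq> pverts G - T"
proof -
  have "Z_iter G T B k \<subseteq> pverts G - T" for k
    by (induction k) auto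
  then show ?thesis
    using Z_lim_stationary[OF assms, of T B] by (auto simp: eventually_sequentially)
qed

lemma Z_lim_controlled_invariant:
  assumes "finite (pverts G)" "v \<in> Z_lim G T B" "(v, w) \<in> parcs G"
  shows "w \<in> Z_lim G T B \<union> B"
proof -
  obtain N where N: "\<And>k. k \<ge> N \<Longrightarrow> Z_iter G T B k = Z_lim G T B"
    using Z_lim_stationary[OF assms(1), of T B] by (auto simp: eventually_sequentially)
  have "Z_iter G T B (Suc N) = Z_lim G T B" "Z_iter G T B N = Z_lim G T B"
    using N by (simp_all del: Z_iter.simps)
  then show ?thesis
    using assms(2,3) by auto
qed

lemma Z_lim_greatest:
  assumes "finite (pverts G)" "Z \<subseteq> pverts G - T"
    and "\<And>v w. v \<in> Z \<Longrightarrow> (v, w) \<in> parcs G \<Longrightarrow> w \<in> Z \<union> B"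
  shows "Z \<subseteq> Z_lim G T B"
proof -
  have "Z \<subseteq> Z_iter G T B k" for k
  proof (induction k)
    case 0
    show ?case using assms(2) by simp
  next
    case (Suc k)
    then show ?case using assms(3) by (simp add: subset_iff) blast
  qed
  then show ?thesis
    using Z_lim_stationary[OF assms(1), of T B] by (auto simp: eventually_sequentially)
qed

text \<open>The boundary condition does not imply feasibility: the empty set always satisfies it.
  Hence a minimum cardinality set subject to the boundary condition is only meaningful when the
  minimum is taken among feasible sets.\<close>

lemma boundary_condition_empty:
  assumes "finite (pverts G)"
  shows "boundary_condition G D T {}"
proof -
  have "out_boundary G (Z_lim G T {}) = {}"
    using Z_lim_controlled_invariant[OF assms, where T = T and B = "{}"]
    unfolding out_boundary_def by blast
  then show ?thesis
    by (simp add: boundary_condition_def)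
qed

end

theory Submission
  imports Defs
begin

text \<open>
  Feasibility is a Menger-type cut condition (\<open>feasible_iff_cut\<close>): \<^term>\<open>B\<close> is feasible
  exactly when every path from \<^term>\<open>D\<close> to \<^term>\<open>T\<close> enters \<^term>\<open>B\<close> after its first node.
  A disturbance that starts in the controlled invariant set can leave it only through an input
  node, and conversely the nodes that are reachable from \<^term>\<open>D\<close> without entering \<^term>\<open>B\<close>
  form a controlled invariant set, which misses \<^term>\<open>T\<close> if \<^term>\<open>B\<close> is a cut.

  The first equality in the boundary condition, \<open>B = \<partial>\<^sub>+Z\<close> for the maximal controlled invariant
  set \<open>Z\<close>, comes from the fact that \<open>\<partial>\<^sub>+Z\<close> always lies in \<^term>\<open>B\<close> and is already enough
  control to keep \<open>Z\<close> invariant, so it is itself feasible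
  (\<open>feasible_out_boundary\<close>); an optimal \<^term>\<open>B\<close> cannot be strictly larger.
  That no node of an optimal \<^term>\<open>B\<close> lies outside the union of the paths is the cut property:
  removing a node destroys feasibility, so some path avoids, after its start, all the other
  nodes of \<^term>\<open>B\<close>, and it must therefore pass through the removed one
  (\<open>irredundant_subset_path_nodes\<close>).

  Finally, since every optimal set satisfies the boundary condition, the minimum over the
  feasible sets with that condition is the minimum over all feasible sets.
\<close>

text \<open>If the new node already occurs on the path, the path is cut off there instead of
  being extended; either way no node other than the new one is added behind the first.\<close>

lemma vpath_extend:
  assumes p: "vpath p H" and w: "w \<in> verts H" and arc: "(last p, w) \<in> arcs_ends H"
  shows "\<exists>q. vpath q H \<and> hd q = hd p \<and> last q = w \<and> set (tl q) \<subseteq> insert w (set (tl p))"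
proof (cases "w \<in> set p")
  case True
  then obtain xs ys where split: "p = xs @ w # ys"
    by (meson split_list)
  have "vwalk ((xs @ [w]) @ ys) H"
    using p split by (auto simp: vpath_def)
  then have "vwalk (xs @ [w]) H"
    by (rule vwalkI_append_l[rotated]) simp
  then have "vpath (xs @ [w]) H"
    using p split by (auto simp: vpath_def)
  moreover have "hd (xs @ [w]) = hd p" "set (tl (xs @ [w])) \<subseteq> insert w (set (tl p))"
    by (cases xs; auto simp: split)+
  ultimately show ?thesis
    by (intro exI[of _ "xs @ [w]"]) simp
next
  case False
  from p have ne: "p \<noteq> []"
    by (auto simp: vpath_def vwalk_def)
  have "vpath (p @ [w]) H"
    using p w arc False ne by (auto simp: vpath_def vwalk_def set_vwalk_arcs_snoc)
  then show ?thesis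
    using ne by (intro exI[of _ "p @ [w]"]) auto
qed

lemma vwalk_last_in_invariant:
  assumes "vwalk p H" and "hd p \<in> Z" and "set (tl p) \<inter> B = {}"
    and "\<And>v w. v \<in> Z \<Longrightarrow> (v, w) \<in> arcs_ends H \<Longrightarrow> w \<in> Z \<union> B"
  shows "last p \<in> Z"
  using assms(1-3)
proof (induction p rule: vwalk_induct)
  case (Base u)
  then show ?case by simp
next
  case (Cons u v es)
  then have "v \<in> Z"
    using assms(4)[of u v] by auto
  with Cons show ?case by simp
qed

text \<open>Only the nodes after the first one count for the cut, because feasibility requires the
  disturbance nodes to lie in the invariant set even when they are input nodes. For
  \<^term>\<open>d \<in> D \<inter> T\<close> the path \<^term>\<open>[d]\<close> has no such node, so the condition forces \<^term>\<open>D\<close> and \<^term>\<open>T\<close> to be disjoint.\<close>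

lemma feasible_iff_cut:
  assumes G: "pair_fin_digraph G" and D: "D \<subseteq> pverts G"
  shows "feasible G D T B \<longleftrightarrow> B \<subseteq> pverts G \<and>
    (\<forall>p. vpath p (with_proj G) \<and> hd p \<in> D \<and> last p \<in> T \<longrightarrow> set (tl p) \<inter> B \<noteq> {})"
    (is "_ \<longleftrightarrow> _ \<and> ?cut")
proof -
  interpret pair_fin_digraph G by fact
  have "?cut" if sub: "D \<subseteq> Z_lim G T B"
  proof (intro allI impI notI)
    fix p assume p: "vpath p (with_proj G) \<and> hd p \<in> D \<and> last p \<in> T"
      and "set (tl p) \<inter> B = {}"
    then have "last p \<in> Z_lim G T B"
      using sub Z_lim_controlled_invariant[of G _ T B]
      by (intro vwalk_last_in_invariant[of p "with_proj G" _ B]) auto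
    with p show False
      using Z_lim_subset[of G T B] by auto
  qed
  moreover have "D \<subseteq> Z_lim G T B" if cut: "?cut"
  proof -
    define R where "R = {last p | p. vpath p (with_proj G) \<and> hd p \<in> D \<and> set (tl p) \<inter> B = {}}"
    have "R \<subseteq> Z_lim G T B"
    proof (rule Z_lim_greatest)
      show "R \<subseteq> pverts G - T"
      proof
        fix v assume "v \<in> R"
        then obtain p where p: "vpath p (with_proj G)" "hd p \<in> D" "set (tl p) \<inter> B = {}" "last p = v"
          by (auto simp: R_def)
        then have "set p \<subseteq> pverts G" "p \<noteq> []"
          by (auto simp: vpath_def vwalk_def)
        then have "v \<in> pverts G"
          using p(4) last_in_set by blast
        moreover have "v \<notin> T"
          using cut p by blast
        ultimately show "v \<in> pverts G - T" by simp
      qed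
    next
      fix v w assume "v \<in> R" and arc: "(v, w) \<in> parcs G"
      then obtain p where p: "vpath p (with_proj G)" "hd p \<in> D" "set (tl p) \<inter> B = {}" "last p = v"
        by (auto simp: R_def)
      obtain q where q: "vpath q (with_proj G)" "hd q = hd p" "last q = w"
          "set (tl q) \<subseteq> insert w (set (tl p))"
        using vpath_extend[OF p(1), of w] p(4) arc in_arcsD2[OF arc] by auto
      show "w \<in> R \<union> B"
      proof (cases "w \<in> B")
        case False
        with p q have "set (tl q) \<inter> B = {}"
          by auto
        with p(2) q show ?thesis
          unfolding R_def by (intro UnI1 CollectI exI[of _ q]) simp
      qed simp
    qed simp
    moreover have "D \<subseteq> R"
    proof
      fix d assume "d \<in> D"
      with D show "d \<in> R"
        unfolding R_def by (intro CollectI exI[of _ "[d]"]) (auto simp: vpath_def vwalk_def)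
    qed
    ultimately show ?thesis by simp
  qed
  ultimately show ?thesis
    unfolding feasible_def by blast
qed

lemma irredundant_subset_path_nodes:
  assumes G: "pair_fin_digraph G" and D: "D \<subseteq> pverts G"
    and B: "feasible G D T B" and irredundant: "\<And>b. b \<in> B \<Longrightarrow> \<not> feasible G D T (B - {b})"
  shows "B \<subseteq> path_nodes G D T"
proof
  fix b assume "b \<in> B"
  obtain p where p: "vpath p (with_proj G)" "hd p \<in> D" "last p \<in> T"
      "set (tl p) \<inter> (B - {b}) = {}"
    using irredundant[OF \<open>b \<in> B\<close>] B unfolding feasible_iff_cut[OF G D] by blast
  with B have "b \<in> set (tl p)"
    unfolding feasible_iff_cut[OF G D] by blast
  then have "b \<in> set p"
    by (cases p) auto
  with p show "b \<in> path_nodes G D T"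
    unfolding path_nodes_def by blast
qed

lemma out_boundary_Z_lim_subset:
  assumes "finite (pverts G)"
  shows "out_boundary G (Z_lim G T B) \<subseteq> B"
  using Z_lim_controlled_invariant[OF assms, of _ T B] by (auto simp: out_boundary_def)

lemma feasible_out_boundary:
  assumes G: "pair_fin_digraph G" and B: "feasible G D T B"
  shows "feasible G D T (out_boundary G (Z_lim G T B))"
proof -
  interpret pair_fin_digraph G by fact
  let ?Z = "Z_lim G T B"
  have "?Z \<subseteq> Z_lim G T (out_boundary G ?Z)"
    by (rule Z_lim_greatest)
      (use Z_lim_subset[of G T B] in \<open>auto simp: out_boundary_def dest: in_arcsD2\<close>)
  with B show ?thesis
    by (auto simp: feasible_def out_boundary_def)
qed

lemma optimal_imp_boundary_condition:
  assumes G: "pair_fin_digraph G" and D: "D \<subseteq> pverts G" and opt: "optimal G D T B"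
  shows "boundary_condition G D T B"
proof -
  interpret pair_fin_digraph G by fact
  from opt have B: "feasible G D T B"
    and least: "\<And>B'. feasible G D T B' \<Longrightarrow> card B \<le> card B'"
    by (auto simp: optimal_def is_arg_min_def not_less)
  then have "finite B"
    by (auto simp: feasible_def intro: finite_subset)
  then have minimal: "B' = B" if "B' \<subseteq> B" "feasible G D T B'" for B'
    using card_seteq[OF \<open>finite B\<close> that(1) least[OF that(2)]] by simp
  have boundary: "out_boundary G (Z_lim G T B) = B"
    using out_boundary_Z_lim_subset[of G T B] feasible_out_boundary[OF G B] by (intro minimal) auto
  moreover have "B \<subseteq> path_nodes G D T"
    using minimal[OF Diff_subset] by (intro irredundant_subset_path_nodes[OF G D B]) auto
  ultimately show ?thesis
    by (auto simp: boundary_condition_def)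
qed

text \<open>If the restricted problem has a candidate, so has the full one, and because the cost is a
  natural number the full problem then has a minimizer. This minimizer meets the restriction, so
  the two problems have the same minimum value.\<close>

lemma is_arg_min_restrict:
  fixes f :: "'b \<Rightarrow> nat"
  assumes keep: "\<And>x. is_arg_min f P x \<Longrightarrow> Q x"
  shows "is_arg_min f P x \<longleftrightarrow> is_arg_min f (\<lambda>y. P y \<and> Q y) x"
proof
  assume "is_arg_min f P x"
  with keep show "is_arg_min f (\<lambda>y. P y \<and> Q y) x"
    by (auto simp: is_arg_min_def)
next
  assume x: "is_arg_min f (\<lambda>y. P y \<and> Q y) x"
  then have "P x"
    by (simp add: is_arg_min_def)
  then obtain y where y: "P y" and least: "\<And>z. P z \<Longrightarrow> f y \<le> f z"
    using ex_has_least_nat[of P x f] by blast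
  have "is_arg_min f P y"
    using y least by (auto simp: is_arg_min_def not_less)
  then have "Q y"
    by (rule keep)
  with x y have "f x \<le> f y"
    by (auto simp: is_arg_min_def not_less)
  then have "f x \<le> f z" if "P z" for z
    using least[OF that] by simp
  with \<open>P x\<close> show "is_arg_min f P x"
    by (auto simp: is_arg_min_def not_less)
qed

theorem theorem6:
  fixes G :: "'a pair_pre_digraph" and A :: "'a \<Rightarrow> 'a \<Rightarrow> real"
    and D T B C :: "'a set"
  assumes "pair_fin_digraph G"
    and "\<forall>i \<in> pverts G. \<forall>j \<in> pverts G. A j i \<noteq> 0 \<longleftrightarrow> (i, j) \<in> parcs G"
    and "D \<subseteq> pverts G" and "T \<subseteq> pverts G" and "B \<subseteq> pverts G" and "C \<subseteq> pverts G"
    and "D \<inter> T = {}" and "D \<inter> B = {}" and "T \<inter> C = {}"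
  shows "(feasible G D T B \<longrightarrow> out_boundary G (Z_lim G T B) \<subseteq> B) \<and>
    (optimal G D T B \<longrightarrow> boundary_condition G D T B) \<and>
    (optimal G D T B \<longleftrightarrow>
       is_arg_min card (\<lambda>B'. feasible G D T B' \<and> boundary_condition G D T B') B)"
proof (intro conjI impI)
  interpret pair_fin_digraph G by fact
  show "out_boundary G (Z_lim G T B) \<subseteq> B"
    by (rule out_boundary_Z_lim_subset) simp
  have keep: "boundary_condition G D T B'" if "is_arg_min card (feasible G D T) B'" for B'
    using optimal_imp_boundary_condition[OF assms(1,3)] that by (simp add: optimal_def)
  then show "boundary_condition G D T B" if "optimal G D T B"
    using that by (simp add: optimal_def)
  show "optimal G D T B \<longleftrightarrow>
      is_arg_min card (\<lambda>B'. feasible G D T B' \<and> boundary_condition G D T B') B"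
    unfolding optimal_def by (rule is_arg_min_restrict) (rule keep)
qed

end
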